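(* Let $\sigma>0$. Let $\mu$ be a centered probability measure on $\mathbb{R}$ (i.e. with mean zero) which admits a density with respect to Lebesgue measure satisfying $$\frac{\mu(dx)}{dx}=e^{-\frac{x^2}{2\sigma^2}-\Phi(x)},$$ where $\Phi:\mathbb{R}\to\mathbb{R}\cup\{+\infty\}$ is a convex function. Let $T_\mu$ be the stopping time defined in the context. Then almost surely $$T_\mu\le\sigma^2.$$
   Context: Definition of $T_\mu$. Let $\mu$ be a Borel probability measure on $\mathbb{R}$ with mean zero and finite second moment. For $b\ge 0$, $c\in\mathbb{R}$ set (whenever the integrals converge; in particular for $b>0$ and for $(b,c)=(0,0)$) $$V_\mu(b,c)=\int_{\mathbb{R}} e^{cx-\frac12 bx^2}\mu(dx),\qquad a_\mu(b,c)=V_\mu(b,c)^{-1}\int_{\mathbb{R}} x\,e^{cx-\frac12 bx^2}\mu(dx),$$ $$A_\mu(b,c)=V_\mu(b,c)^{-1}\int_{\mathbb{R}}(x-a_\mu(b,c))^2e^{cx-\frac12 bx^2}\mu(dx).$$ Let $W_t$ be a standard Wiener process and consider the system of stochastic differential equations $$c_0=0,\quad dc_t=A_\mu^{-1}(b_t,c_t)\,dW_t+A_\mu^{-2}(b_t,c_t)\,a_\mu(b_t,c_t)\,dt,\qquad b_0=0,\quad db_t=A_\mu^{-2}(b_t,c_t)\,dt.$$ This system has a unique maximal solution, with $b_t>0$ for $t>0$. $T_\mu$ is the supremum of the set of times up to which the solution exists ($T_\mu=\infty$ if it exists for all $t\ge 0$); equivalently, almost surely, the solution exists exactly on $[0,T_\mu)$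 and $T_\mu=\sup\{t\ge 0:\ A_\mu(b_t,c_t)>0\}$. *)

theory Defs
  imports "HOL-Probability.Probability"
begin

section \<open>Gaussian tilts of a measure on the line\<close>

definition tilt_V :: "real measure \<Rightarrow> real \<Rightarrow> real \<Rightarrow> real" where
  "tilt_V \<mu> b c = (LINT x|\<mu>. exp (c * x - b * x\<^sup>2 / 2))"

definition tilt_a :: "real measure \<Rightarrow> real \<Rightarrow> real \<Rightarrow> real" where
  "tilt_a \<mu> b c = inverse (tilt_V \<mu> b c) * (LINT x|\<mu>. x * exp (c * x - b * x\<^sup>2 / 2))"

definition tilt_A :: "real measure \<Rightarrow> real \<Rightarrow> real \<Rightarrow> real" where
  "tilt_A \<mu> b c =
     inverse (tilt_V \<mu> b c) * (LINT x|\<mu>. (x - tilt_a \<mu> b c)\<^sup>2 * exp (c * x - b * x\<^sup>2 / 2))"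

text \<open>
  The pairs (b, c) at which the coefficients of the system are meaningful.  Both conditions have
  to be spelled out because a divergent integral and the inverse of 0 are 0 by convention.
\<close>

definition sde_domain :: "real measure \<Rightarrow> (real \<times> real) set" where
  "sde_domain \<mu> = {(b, c). 0 \<le> b \<and>
     integrable \<mu> (\<lambda>x. exp (c * x - b * x\<^sup>2 / 2)) \<and>
     integrable \<mu> (\<lambda>x. x * exp (c * x - b * x\<^sup>2 / 2)) \<and>
     integrable \<mu> (\<lambda>x. x\<^sup>2 * exp (c * x - b * x\<^sup>2 / 2)) \<and>
     0 < tilt_A \<mu> b c}"

section \<open>Wiener processes and the stochastic integral\<close>

text \<open>
  Time is of type real, but only times \<open>t \<ge> 0\<close> carry meaning.  A filtration on the half line is
  regarded as one indexed by all reals by putting, say, \<open>F t = F 0\<close> for \<open>t < 0\<close>.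
  Processes may take arbitrary values at negative times.
\<close>

definition filtered_prob_space :: "'a measure \<Rightarrow> (real \<Rightarrow> 'a measure) \<Rightarrow> bool" where
  "filtered_prob_space M F \<longleftrightarrow>
     prob_space M \<and> filtration (space M) F \<and> (\<forall>t. sets (F t) \<subseteq> sets M)"

definition wiener_process ::
  "'a measure \<Rightarrow> (real \<Rightarrow> 'a measure) \<Rightarrow> (real \<Rightarrow> 'a \<Rightarrow> real) \<Rightarrow> bool" where
  "wiener_process M F W \<longleftrightarrow>
     (AE \<omega> in M. W 0 \<omega> = 0 \<and> continuous_on {0..} (\<lambda>t. W t \<omega>)) \<and>
     (\<forall>t\<ge>0. W t \<in> borel_measurable (F t)) \<and>
     (\<forall>s t. 0 \<le> s \<and> s < t \<longrightarrow>
        distributed M lborel (\<lambda>\<omega>. W t \<omega> - W s \<omega>) (normal_density 0 (sqrt (t - s))) \<and>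
        prob_space.indep_set M (sets (F s))
          (sets (vimage_algebra (space M) (\<lambda>\<omega>. W t \<omega> - W s \<omega>) borel)))"

definition simple_integrand ::
  "(real \<Rightarrow> 'a measure) \<Rightarrow> nat \<Rightarrow> (nat \<Rightarrow> real) \<Rightarrow> (nat \<Rightarrow> 'a \<Rightarrow> real) \<Rightarrow> bool" where
  "simple_integrand F n p \<xi> \<longleftrightarrow> 0 \<le> p 0 \<and>
     (\<forall>i<n. p i \<le> p (Suc i) \<and> \<xi> i \<in> borel_measurable (F (p i)) \<and>
            (\<exists>K. \<forall>\<omega>\<in>space (F (p i)). \<bar>\<xi> i \<omega>\<bar> \<le> K))"

definition simple_process ::
  "nat \<Rightarrow> (nat \<Rightarrow> real) \<Rightarrow> (nat \<Rightarrow> 'a \<Rightarrow> real) \<Rightarrow> real \<Rightarrow> 'a \<Rightarrow> real" where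
  "simple_process n p \<xi> s \<omega> = (\<Sum>i<n. \<xi> i \<omega> * indicator {p i<..p (Suc i)} s)"

definition simple_integral ::
  "(real \<Rightarrow> 'a \<Rightarrow> real) \<Rightarrow> nat \<Rightarrow> (nat \<Rightarrow> real) \<Rightarrow> (nat \<Rightarrow> 'a \<Rightarrow> real) \<Rightarrow> real \<Rightarrow> 'a \<Rightarrow> real" where
  "simple_integral W n p \<xi> t \<omega> =
     (\<Sum>i<n. \<xi> i \<omega> * (W (min (p (Suc i)) t) \<omega> - W (min (p i) t) \<omega>))"

definition progressively_measurable ::
  "(real \<Rightarrow> 'a measure) \<Rightarrow> (real \<Rightarrow> 'a \<Rightarrow> real) \<Rightarrow> bool" where
  "progressively_measurable F H \<longleftrightarrow>
     (\<forall>t\<ge>0. (\<lambda>(s, \<omega>). H s \<omega>) \<in> borel_measurable (restrict_space borel {0..t} \<Otimes>\<^sub>M F t))"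

text \<open>
  The process I is (a version of) the Ito integral of H against W: the usual extension of the
  integral of simple processes to progressively measurable integrands which are almost surely
  square integrable on bounded time intervals.  The square integrability of H is a consequence of
  its approximability by (bounded) simple processes, and I is determined up to
  indistinguishability, being continuous and given at each time as a limit in probability.
\<close>

definition is_ito_integral ::
  "'a measure \<Rightarrow> (real \<Rightarrow> 'a measure) \<Rightarrow> (real \<Rightarrow> 'a \<Rightarrow> real) \<Rightarrow>
   (real \<Rightarrow> 'a \<Rightarrow> real) \<Rightarrow> (real \<Rightarrow> 'a \<Rightarrow> real) \<Rightarrow> bool" where
  "is_ito_integral M F W H I \<longleftrightarrow>
     progressively_measurable F H \<and>
     (\<forall>t\<ge>0. I t \<in> borel_measurable (F t)) \<and>
     (AE \<omega> in M. continuous_on {0..} (\<lambda>t. I t \<omega>)) \<and>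
     (\<exists>n p \<xi>. (\<forall>k. simple_integrand F (n k) (p k) (\<xi> k)) \<and>
        (\<forall>t\<ge>0. \<forall>\<epsilon>>0.
           (\<lambda>k. measure M {\<omega> \<in> space M.
               ennreal \<epsilon> < (\<integral>\<^sup>+ s\<in>{0..t}. ennreal ((simple_process (n k) (p k) (\<xi> k) s \<omega> - H s \<omega>)\<^sup>2) \<partial>lborel)})
             \<longlonglongrightarrow> 0 \<and>
           (\<lambda>k. measure M {\<omega> \<in> space M.
               \<epsilon> < \<bar>simple_integral W (n k) (p k) (\<xi> k) t \<omega> - I t \<omega>\<bar>})
             \<longlonglongrightarrow> 0))"

section \<open>The system of stochastic differential equations\<close>

text \<open>
  The pair (b, c) solves the system on the random interval \<open>[0, T)\<close>, where T is a stopping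
  time which may be infinite; the values of b and c from time T on are irrelevant.  As usual, the
  stochastic integral on \<open>[0, T)\<close> is understood by localisation: along stopping times
  \<open>\<tau> n < T\<close> increasing to T, the stopped process
  \<open>c (min t (\<tau> n)) - (integral of A^(-2) a over [0, min t (\<tau> n)])\<close>
  is the Ito integral of \<open>A^(-1)\<close> restricted to \<open>[0, \<tau> n]\<close>.
\<close>

definition sde_solution ::
  "real measure \<Rightarrow> 'a measure \<Rightarrow> (real \<Rightarrow> 'a measure) \<Rightarrow> (real \<Rightarrow> 'a \<Rightarrow> real) \<Rightarrow>
   (real \<Rightarrow> 'a \<Rightarrow> real) \<Rightarrow> (real \<Rightarrow> 'a \<Rightarrow> real) \<Rightarrow> ('a \<Rightarrow> ereal) \<Rightarrow> bool" where
  "sde_solution \<mu> M F W b c T \<longleftrightarrow>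
     (let A = (\<lambda>s \<omega>. tilt_A \<mu> (b s \<omega>) (c s \<omega>));
          a = (\<lambda>s \<omega>. tilt_a \<mu> (b s \<omega>) (c s \<omega>))
      in
       (\<forall>t. Measurable.pred (F t) (\<lambda>\<omega>. T \<omega> \<le> ereal t)) \<and>
       (\<forall>t\<ge>0. (\<lambda>\<omega>. if ereal t < T \<omega> then b t \<omega> else 0) \<in> borel_measurable (F t) \<and>
               (\<lambda>\<omega>. if ereal t < T \<omega> then c t \<omega> else 0) \<in> borel_measurable (F t)) \<and>
       (AE \<omega> in M. b 0 \<omega> = 0 \<and> c 0 \<omega> = 0 \<and>
          continuous_on {t. 0 \<le> t \<and> ereal t < T \<omega>} (\<lambda>t. b t \<omega>) \<and>
          continuous_on {t. 0 \<le> t \<and> ereal t < T \<omega>} (\<lambda>t. c t \<omega>) \<and>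
          (\<forall>t. 0 \<le> t \<and> ereal t < T \<omega> \<longrightarrow>
             (b t \<omega>, c t \<omega>) \<in> sde_domain \<mu> \<and>
             set_integrable lborel {0..t} (\<lambda>s. inverse (A s \<omega>) ^ 2) \<and>
             set_integrable lborel {0..t} (\<lambda>s. inverse (A s \<omega>) ^ 2 * a s \<omega>) \<and>
             b t \<omega> = (LBINT s:{0..t}. inverse (A s \<omega>) ^ 2))) \<and>
       (\<exists>\<tau> :: nat \<Rightarrow> 'a \<Rightarrow> real.
          (\<forall>n. stopping_time F (\<tau> n)) \<and>
          (AE \<omega> in M. (\<forall>n. 0 \<le> \<tau> n \<omega> \<and> \<tau> n \<omega> \<le> \<tau> (Suc n) \<omega> \<and> ereal (\<tau> n \<omega>) < T \<omega>) \<and>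
                      (\<lambda>n. ereal (\<tau> n \<omega>)) \<longlonglongrightarrow> T \<omega>) \<and>
          (\<forall>n. is_ito_integral M F W
             (\<lambda>s \<omega>. if s \<le> \<tau> n \<omega> then inverse (A s \<omega>) else 0)
             (\<lambda>t \<omega>. c (min t (\<tau> n \<omega>)) \<omega>
                     - (LBINT s:{0..min t (\<tau> n \<omega>)}. inverse (A s \<omega>) ^ 2 * a s \<omega>)))))"

text \<open>
  A solution living at least as long as every other one.  Its lifetime T is the stopping time
  attached to the measure: the supremum of the times up to which the system can be solved,
  determined up to null sets.
\<close>

definition maximal_sde_solution ::
  "real measure \<Rightarrow> 'a measure \<Rightarrow> (real \<Rightarrow> 'a measure) \<Rightarrow> (real \<Rightarrow> 'a \<Rightarrow> real) \<Rightarrow>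
   (real \<Rightarrow> 'a \<Rightarrow> real) \<Rightarrow> (real \<Rightarrow> 'a \<Rightarrow> real) \<Rightarrow> ('a \<Rightarrow> ereal) \<Rightarrow> bool" where
  "maximal_sde_solution \<mu> M F W b c T \<longleftrightarrow>
     sde_solution \<mu> M F W b c T \<and>
     (\<forall>b' c' T'. sde_solution \<mu> M F W b' c' T' \<longrightarrow> (AE \<omega> in M. T' \<omega> \<le> T \<omega>))"

section \<open>Convex functions with values in the extended reals\<close>

text \<open>The convention \<open>0 * \<infinity> = 0\<close> makes the degenerate cases \<open>u = 0\<close> and \<open>v = 0\<close> trivial.\<close>

definition ereal_convex :: "(real \<Rightarrow> ereal) \<Rightarrow> bool" where
  "ereal_convex \<Phi> \<longleftrightarrow>
     (\<forall>x y u v. 0 \<le> u \<and> 0 \<le> v \<and> u + v = 1 \<longrightarrow>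
        \<Phi> (u * x + v * y) \<le> ereal u * \<Phi> x + ereal v * \<Phi> y)"

definition exp_ereal :: "ereal \<Rightarrow> ennreal" where
  "exp_ereal z = (case z of ereal r \<Rightarrow> ennreal (exp r) | PInfty \<Rightarrow> \<infinity> | MInfty \<Rightarrow> 0)"

end

theory Submission
  imports Defs
begin

text \<open>
  The stochastic integral plays no role: the bound holds along almost every path.
  The tilt at \<open>(b, c)\<close> has density
  proportional to \<open>exp (- \<kappa> x\<^sup>2 / 2 - \<phi> x)\<close> with \<open>\<phi>\<close> convex and \<open>\<kappa> = b + 1/\<sigma>\<^sup>2\<close>, so by the
  one-dimensional Brascamp--Lieb inequality its variance A is at most \<open>1/\<kappa>\<close>.  Therefore
  \<open>b' = A\<^sup>-\<^sup>2 \<ge> (b + 1/\<sigma>\<^sup>2)\<^sup>2\<close> with \<open>b 0 = 0\<close>, and b explodes no later than at time \<open>\<sigma>\<^sup>2\<close>.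
\<close>

section \<open>The variance of a strongly log-concave density\<close>

text \<open>
  Instead of integrating by parts, which would bring in boundary terms, h is compared with its
  dilation by \<open>l < 1\<close> about the mean a: convexity bounds \<open>h (a + l (x - a))\<close> from below by
  h times an affine function of \<open>(x - a)\<^sup>2\<close> and \<open>x - a\<close>, and \<open>l\<close> is sent to 1 after integration.
\<close>

lemma strongly_log_concave_variance:
  fixes h \<phi> :: "real \<Rightarrow> real" and I :: "real set" and a \<kappa> :: real
  assumes conv: "convex_on I \<phi>" and a: "a \<in> interior I"
    and h: "\<And>x. h x = (if x \<in> I then exp (- (\<kappa> * x\<^sup>2 / 2) - \<phi> x) else 0)"
    and int0: "integrable lborel h"
    and int1: "integrable lborel (\<lambda>x. (x - a) * h x)"
    and int2: "integrable lborel (\<lambda>x. (x - a)\<^sup>2 * h x)"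
    and mean: "(LINT x|lborel. (x - a) * h x) = 0"
  shows "\<kappa> * (LINT x|lborel. (x - a)\<^sup>2 * h x) \<le> (LINT x|lborel. h x)"
proof -
  define V where "V = (LINT x|lborel. h x)"
  define S where "S = (LINT x|lborel. (x - a)\<^sup>2 * h x)"
  \<comment> \<open>A supporting line of \<open>\<phi>\<close> at a, available because a is interior
    to I. Its slope \<open>s\<close> only enters terms linear in \<open>x - a\<close>, which
    \<open>mean\<close> annihilates after integration.\<close>
  obtain s where s: "\<And>x. x \<in> I \<Longrightarrow> \<phi> x \<ge> \<phi> a + s * (x - a)"
    using convex_le_Inf_differential[OF conv a] by blast
  have aI: "a \<in> I"
    using a interior_subset by blast
  have bound: "l * (1 + l) / 2 * (\<kappa> * S) \<le> V" if l: "0 < l" "l < 1" for l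
  proof -
    have pointwise: "h x + \<kappa> * (1 - l\<^sup>2) / 2 * ((x - a)\<^sup>2 * h x)
        + (1 - l) * (s + \<kappa> * a) * ((x - a) * h x) \<le> h ((1 - l) * a + l * x)" for x
    proof (cases "x \<in> I")
      case False
      then show ?thesis
        by (simp add: h)
    next
      case True
      define z where "z = (1 - l) * a + l * x"
      define e where "e = \<kappa> * (1 - l\<^sup>2) / 2 * (x - a)\<^sup>2 + (1 - l) * (s + \<kappa> * a) * (x - a)"
      have zI: "z \<in> I"
        using convexD[OF convex_on_imp_convex[OF conv] aI True, of "1 - l" l] l
        by (simp add: z_def)
      have "\<phi> z \<le> (1 - l) * \<phi> a + l * \<phi> x"
        using convex_onD[OF conv, of l a x] l aI True by (simp add: z_def)
      \<comment> \<open>The supporting line trades \<open>\<phi> a\<close> for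
        \<open>\<phi> x\<close>, so that \<open>h z\<close> can be compared with \<open>h x\<close>
        alone.\<close>
      moreover have "(1 - l) * \<phi> a \<le> (1 - l) * (\<phi> x - s * (x - a))"
        using s[OF True] l by (intro mult_left_mono) auto
      ultimately have "\<phi> z \<le> \<phi> x - (1 - l) * s * (x - a)"
        by (simp add: algebra_simps)
      moreover have "\<kappa> * x\<^sup>2 / 2 - \<kappa> * z\<^sup>2 / 2
          = \<kappa> * (1 - l\<^sup>2) / 2 * (x - a)\<^sup>2 + (1 - l) * (\<kappa> * a) * (x - a)"
        unfolding z_def by (simp add: field_simps power2_eq_square)
      ultimately have "- (\<kappa> * x\<^sup>2 / 2) - \<phi> x + e \<le> - (\<kappa> * z\<^sup>2 / 2) - \<phi> z"
        unfolding e_def by (simp add: distrib_left distrib_right)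
      then have "h x * exp e \<le> h z"
        using True zI by (simp add: h flip: exp_add)
      \<comment> \<open>Linearising by \<open>1 + e \<le> exp e\<close> leaves only the moments of h
        of order at most two.\<close>
      moreover have "h x * (1 + e) \<le> h x * exp e"
        by (intro mult_left_mono) (auto simp: h)
      ultimately show ?thesis
        unfolding z_def e_def by (simp add: algebra_simps)
    qed
    have int_dil: "integrable lborel (\<lambda>x. h ((1 - l) * a + l * x))"
      using lborel_integrable_real_affine[OF int0, of l "(1 - l) * a"] l by simp
    have "V + \<kappa> * (1 - l\<^sup>2) / 2 * S
        = (LINT x|lborel. h x + \<kappa> * (1 - l\<^sup>2) / 2 * ((x - a)\<^sup>2 * h x)
            + (1 - l) * (s + \<kappa> * a) * ((x - a) * h x))"
      using int0 int1 int2 by (simp add: V_def S_def mean)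
    also have "\<dots> \<le> (LINT x|lborel. h ((1 - l) * a + l * x))"
      using int0 int1 int2 int_dil pointwise by (intro integral_mono) auto
    also have "\<dots> = V / l"
      using lborel_integral_real_affine[of l h "(1 - l) * a"] l by (simp add: V_def field_simps)
    finally have "l * (V + \<kappa> * (1 - l\<^sup>2) / 2 * S) \<le> V"
      using l by (simp add: field_simps)
    \<comment> \<open>The dilation changes the mass by the factor \<open>1 / l\<close>, so both the
      excess mass and the variance term are of first order in \<open>1 - l\<close>. This common
      factor cancels before l tends to 1.\<close>
    then have "(1 - l) * (l * (1 + l) / 2 * (\<kappa> * S)) \<le> (1 - l) * V"
      by (simp add: field_simps power2_eq_square)
    then show ?thesis
      using l by simp
  qed
  have "((\<lambda>l. l * (1 + l) / 2 * (\<kappa> * S)) \<longlongrightarrow> 1 * (1 + 1) / 2 * (\<kappa> * S)) (at_left (1::real))"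
    by (intro tendsto_intros) auto
  moreover have "\<forall>\<^sub>F l in at_left (1::real). l * (1 + l) / 2 * (\<kappa> * S) \<le> V"
    using eventually_at_left_real[of 0 1] by (rule eventually_mono) (use bound in auto)
  ultimately have "1 * (1 + 1) / 2 * (\<kappa> * S) \<le> V"
    by (intro tendsto_upperbound) auto
  then show ?thesis
    by (simp add: V_def S_def)
qed

text \<open>If I lay on one side of a, \<open>(x - a) * h x\<close> would have constant sign and
  zero integral, so h would vanish almost everywhere. Interiority is what provides a supporting line
  at the mean.\<close>

lemma mean_in_interior_support:
  fixes h :: "real \<Rightarrow> real" and I :: "real set" and a :: real
  assumes conv: "convex I" and nonneg: "\<And>x. 0 \<le> h x" and supp: "\<And>x. x \<notin> I \<Longrightarrow> h x = 0"
    and int1: "integrable lborel (\<lambda>x. (x - a) * h x)"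
    and mean: "(LINT x|lborel. (x - a) * h x) = 0"
    and mass: "(LINT x|lborel. h x) \<noteq> 0"
  shows "a \<in> interior I"
proof -
  have side: "\<exists>x\<in>I. 0 < s * (x - a)" if s: "s \<noteq> 0" for s
  proof (rule ccontr)
    assume "\<not> ?thesis"
    then have "0 \<le> - s * ((x - a) * h x)" for x
      using supp[of x] nonneg[of x]
      by (cases "x \<in> I") (auto simp: not_less mult_nonpos_nonneg simp flip: mult.assoc)
    then have "AE x in lborel. - s * ((x - a) * h x) = 0"
      using int1 mean by (subst integral_nonneg_eq_0_iff_AE[symmetric]) auto
    then have "AE x in lborel. h x = 0"
      using AE_lborel_singleton[of a] by eventually_elim (use s in auto)
    then have "(LINT x|lborel. h x) = 0"
      by (rule integral_eq_zero_AE)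
    with mass show False ..
  qed
  obtain y where y: "y \<in> I" "a < y"
    using side[of 1] by auto
  obtain x where x: "x \<in> I" "x < a"
    using side[of "-1"] by auto
  have "{x..y} \<subseteq> I"
    using conv x y by (meson atLeastAtMost_iff is_interval_convex_1 mem_is_interval_1_I subsetI)
  then have "interior {x..y} \<subseteq> interior I"
    by (rule interior_mono)
  then show ?thesis
    using x y by auto
qed

section \<open>Extended-valued convex functions\<close>

lemma ereal_convexD:
  assumes "ereal_convex \<Phi>" "0 \<le> u" "0 \<le> v" "u + v = 1"
  shows "\<Phi> (u * x + v * y) \<le> ereal u * \<Phi> x + ereal v * \<Phi> y"
  using assms by (auto simp: ereal_convex_def)

lemma ereal_convex_sublevel:
  assumes conv: "ereal_convex \<Phi>" and fin: "\<forall>x. \<Phi> x \<noteq> -\<infinity>"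
  shows "convex {x. \<Phi> x \<le> z}"
proof (cases z)
  case (real r)
  show ?thesis
  proof (rule convexI)
    fix x y u v :: real
    assume xy: "x \<in> {x. \<Phi> x \<le> z}" "y \<in> {x. \<Phi> x \<le> z}" and uv: "0 \<le> u" "0 \<le> v" "u + v = 1"
    obtain p q where pq: "\<Phi> x = ereal p" "\<Phi> y = ereal q"
      using xy fin real by (cases "\<Phi> x"; cases "\<Phi> y") auto
    have "u * p + v * q \<le> r"
      using xy uv pq real by (intro convex_bound_le) auto
    with ereal_convexD[OF conv uv, of x y] show "u *\<^sub>R x + v *\<^sub>R y \<in> {x. \<Phi> x \<le> z}"
      using pq real by (auto intro: order_trans)
  qed
qed (use fin in auto)

text \<open>Convex sublevel sets on the line are intervals, hence Borel. This also covers jumps of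
  \<open>\<Phi>\<close> at the ends of its effective domain.\<close>

lemma borel_measurable_ereal_convex:
  assumes "ereal_convex \<Phi>" "\<forall>x. \<Phi> x \<noteq> -\<infinity>"
  shows "\<Phi> \<in> borel_measurable borel"
  using ereal_convex_sublevel[OF assms]
  by (intro borel_measurableI_le)
    (auto intro!: real_interval_borel_measurable simp: is_interval_convex_1)

lemma convex_on_real_of_ereal_convex:
  assumes conv: "ereal_convex \<Phi>" and fin: "\<forall>x. \<Phi> x \<noteq> -\<infinity>"
  shows "convex_on {x. \<Phi> x \<noteq> \<infinity>} (\<lambda>x. real_of_ereal (\<Phi> x))"
proof -
  have bound: "\<Phi> (u * x + v * y) \<noteq> \<infinity> \<and>
      real_of_ereal (\<Phi> (u * x + v * y)) \<le> u * real_of_ereal (\<Phi> x) + v * real_of_ereal (\<Phi> y)"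
    if xy: "\<Phi> x \<noteq> \<infinity>" "\<Phi> y \<noteq> \<infinity>" and uv: "0 \<le> u" "0 \<le> v" "u + v = 1" for x y u v
  proof -
    obtain p q where "\<Phi> x = ereal p" "\<Phi> y = ereal q"
      using xy fin by (cases "\<Phi> x"; cases "\<Phi> y") auto
    then show ?thesis
      using ereal_convexD[OF conv uv, of x y] fin[rule_format, of "u * x + v * y"]
      by (cases "\<Phi> (u * x + v * y)") auto
  qed
  show ?thesis
    unfolding convex_on_def using bound by (auto intro!: convexI)
qed

section \<open>The variance of the tilts\<close>

lemma tilt_A_le:
  fixes \<mu> :: "real measure" and \<Phi> :: "real \<Rightarrow> ereal"
  assumes fin: "\<forall>x. \<Phi> x \<noteq> -\<infinity>" and conv: "ereal_convex \<Phi>"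
    and \<mu>: "\<mu> = density lborel (\<lambda>x. exp_ereal (ereal (- (k * x\<^sup>2 / 2)) - \<Phi> x))"
    and dom: "(b, c) \<in> sde_domain \<mu>"
  shows "(b + k) * tilt_A \<mu> b c \<le> 1"
proof -
  define I where "I = {x. \<Phi> x \<noteq> \<infinity>}"
  define p where "p x = (if x \<in> I then exp (- (k * x\<^sup>2 / 2) - real_of_ereal (\<Phi> x)) else 0)" for x
  \<comment> \<open>The unnormalised Lebesgue density of the tilt. Its quadratic exponent raises k
    to \<open>b + k\<close>, while the linear one is absorbed into \<open>\<phi>\<close> without
    affecting convexity.\<close>
  define h where "h = (\<lambda>x. p x * exp (c * x - b * x\<^sup>2 / 2))"
  define \<phi> where "\<phi> x = real_of_ereal (\<Phi> x) - c * x" for x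
  define a where "a = tilt_a \<mu> b c"
  define V where "V = tilt_V \<mu> b c"
  note [measurable] = borel_measurable_ereal_convex[OF conv fin]
  have [measurable]: "p \<in> borel_measurable borel"
    unfolding p_def I_def by measurable
  have p_nonneg: "0 \<le> p x" for x
    by (simp add: p_def)
  have "exp_ereal (ereal (- (k * x\<^sup>2 / 2)) - \<Phi> x) = ennreal (p x)" for x
    using fin by (cases "\<Phi> x") (auto simp: exp_ereal_def p_def I_def)
  then have \<mu>_p: "\<mu> = density lborel p"
    unfolding \<mu> by simp
  have integrable_\<mu>: "integrable \<mu> f \<longleftrightarrow> integrable lborel (\<lambda>x. p x * f x)"
    and integral_\<mu>: "(LINT x|\<mu>. f x) = (LINT x|lborel. p x * f x)"
    if "f \<in> borel_measurable borel" for f :: "real \<Rightarrow> real"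
    using that p_nonneg by (simp_all add: \<mu>_p integrable_density integral_density)
  have int: "integrable lborel h" "integrable lborel (\<lambda>x. x * h x)"
      "integrable lborel (\<lambda>x. x\<^sup>2 * h x)" and A_pos: "0 < tilt_A \<mu> b c"
    using dom by (auto simp: sde_domain_def integrable_\<mu> h_def mult_ac)
  have V_eq: "V = (LINT x|lborel. h x)"
    by (simp add: V_def tilt_V_def integral_\<mu> h_def)
  have a_eq: "a = inverse V * (LINT x|lborel. x * h x)"
    by (simp add: a_def V_def tilt_a_def integral_\<mu> h_def mult_ac)
  have A_eq: "tilt_A \<mu> b c = inverse V * (LINT x|lborel. (x - a)\<^sup>2 * h x)"
    unfolding tilt_A_def by (simp add: a_def V_def integral_\<mu> h_def mult_ac)
  have h_nonneg: "0 \<le> h x" for x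
    by (simp add: h_def p_nonneg)
  \<comment> \<open>As \<open>inverse 0 = 0\<close>, a vanishing V would make \<open>tilt_A\<close>
    vanish, against its positivity on the domain.\<close>
  have "V \<noteq> 0"
    using A_pos A_eq by auto
  then have V_pos: "0 < V"
    using Bochner_Integration.integral_nonneg[of lborel h] h_nonneg by (simp add: V_eq order_less_le)
  have int1: "integrable lborel (\<lambda>x. (x - a) * h x)"
    using int by (simp add: left_diff_distrib)
  have int2: "integrable lborel (\<lambda>x. (x - a)\<^sup>2 * h x)"
  proof -
    have "(\<lambda>x. (x - a)\<^sup>2 * h x) = (\<lambda>x. x\<^sup>2 * h x - 2 * a * (x * h x) + a\<^sup>2 * h x)"
      by (simp add: fun_eq_iff power2_eq_square algebra_simps)
    then show ?thesis
      using int by simp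
  qed
  have mean: "(LINT x|lborel. (x - a) * h x) = 0"
    using int V_pos by (simp add: left_diff_distrib a_eq flip: V_eq)
  have mass: "(LINT x|lborel. h x) \<noteq> 0"
    using V_pos V_eq by simp
  have conv_I: "convex_on I (\<lambda>x. real_of_ereal (\<Phi> x))"
    unfolding I_def by (rule convex_on_real_of_ereal_convex[OF conv fin])
  then have "convex I"
    by (rule convex_on_imp_convex)
  have conv_\<phi>: "convex_on I \<phi>"
    unfolding \<phi>_def
    by (intro convex_on_diff conv_I)
      (use \<open>convex I\<close> in \<open>simp add: concave_on_iff algebra_simps\<close>)
  have "a \<in> interior I"
    by (rule mean_in_interior_support[OF \<open>convex I\<close> h_nonneg _ int1 mean mass])
      (simp add: h_def p_def)
  moreover have "h x = (if x \<in> I then exp (- ((b + k) * x\<^sup>2 / 2) - \<phi> x) else 0)" for x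
    by (simp add: h_def p_def \<phi>_def field_simps flip: exp_add)
  ultimately have "(b + k) * (LINT x|lborel. (x - a)\<^sup>2 * h x) \<le> V"
    unfolding V_eq using strongly_log_concave_variance[OF conv_\<phi> _ _ int(1) int1 int2 mean] by blast
  then show ?thesis
    using V_pos by (simp add: A_eq field_simps)
qed

section \<open>Explosion of the Riccati inequality\<close>

text \<open>A positive g with \<open>g' \<ge> g\<^sup>2\<close> makes \<open>- 1 / g\<close>
  increase at least at unit speed. Starting from \<open>- 1 / k\<close> and staying negative, it can
  do so only for a time less than \<open>1 / k\<close>.\<close>

lemma riccati_explosion:
  fixes b :: "real \<Rightarrow> real"
  assumes k: "0 < k" and S: "0 \<le> S" and cont: "continuous_on {0..S} b"
    and ineq: "\<And>t. t \<in> {0..S} \<Longrightarrow> integral {0..t} (\<lambda>s. (b s + k)\<^sup>2) \<le> b t"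
  shows "S < 1 / k"
proof -
  \<comment> \<open>b is only assumed continuous, so it is replaced by a differentiable minorant:
    \<open>g \<le> b + k\<close>, and therefore
    \<open>g' = (b + k)\<^sup>2 \<ge> g\<^sup>2\<close>.\<close>
  define g where "g t = integral {0..t} (\<lambda>s. (b s + k)\<^sup>2) + k" for t
  have cont_sq: "continuous_on {0..S} (\<lambda>s. (b s + k)\<^sup>2)"
    using cont by (intro continuous_intros)
  have g_pos: "0 < g t" if "t \<in> {0..S}" for t
  proof -
    have "(\<lambda>s. (b s + k)\<^sup>2) integrable_on {0..t}"
      using that by (intro integrable_continuous_real continuous_on_subset[OF cont_sq]) auto
    then have "0 \<le> integral {0..t} (\<lambda>s. (b s + k)\<^sup>2)"
      by (rule Henstock_Kurzweil_Integration.integral_nonneg) simp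
    then show ?thesis
      using k by (simp add: g_def)
  qed
  have g_deriv: "(g has_real_derivative (b t + k)\<^sup>2) (at t within {0..S})" if "t \<in> {0..S}" for t
    unfolding g_def
    using DERIV_add[OF integral_has_real_derivative[OF cont_sq that] DERIV_const[of k]] by simp
  have "((\<lambda>t. - inverse (g t) - t) has_derivative (\<lambda>x. x * ((b t + k)\<^sup>2 / (g t)\<^sup>2 - 1)))
      (at t within {0..S})" if "0 \<le> t" "t \<le> S" for t
  proof -
    have "((\<lambda>t. - inverse (g t) - t) has_real_derivative (b t + k)\<^sup>2 / (g t)\<^sup>2 - 1) (at t within {0..S})"
      using that g_pos[of t]
      by (auto intro!: derivative_eq_intros g_deriv simp: field_simps power2_eq_square)
    then show ?thesis
      by (simp add: has_field_derivative_def mult_commute_abs)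
  qed
  from mvt_very_simple[OF S this] obtain t where t: "t \<in> {0..S}"
    and eq: "- inverse (g S) - S - (- inverse (g 0) - 0) = (S - 0) * ((b t + k)\<^sup>2 / (g t)\<^sup>2 - 1)"
    by auto
  have "(g t)\<^sup>2 \<le> (b t + k)\<^sup>2"
    using ineq[OF t] g_pos[OF t] by (intro power_mono) (auto simp: g_def)
  then have "1 \<le> (b t + k)\<^sup>2 / (g t)\<^sup>2"
    using g_pos[OF t] by simp
  then have "0 \<le> (S - 0) * ((b t + k)\<^sup>2 / (g t)\<^sup>2 - 1)"
    using S by simp
  then have "S + inverse (g S) \<le> inverse (g 0)"
    unfolding eq[symmetric] by simp
  \<comment> \<open>Positivity of g at the end time makes the bound strict, which yields the
    contradiction when \<open>S = 1 / k\<close>.\<close>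
  moreover have "S < S + inverse (g S)"
    using g_pos[of S] S by simp
  moreover have "inverse (g 0) = 1 / k"
    by (simp add: g_def inverse_eq_divide)
  ultimately show ?thesis
    by linarith
qed

theorem theorem1p4:
  fixes \<sigma> :: real
    and \<mu> :: "real measure"
    and \<Phi> :: "real \<Rightarrow> ereal"
    and M :: "'a measure"
    and F :: "real \<Rightarrow> 'a measure"
    and W b c :: "real \<Rightarrow> 'a \<Rightarrow> real"
    and T :: "'a \<Rightarrow> ereal"
  assumes "\<sigma> > 0"
    and "prob_space \<mu>"
    and "integrable \<mu> (\<lambda>x. x)" and "(LINT x|\<mu>. x) = 0"
    and "\<forall>x. \<Phi> x \<noteq> -\<infinity>" and "ereal_convex \<Phi>"
    and "\<mu> = density lborel (\<lambda>x. exp_ereal (ereal (- (x\<^sup>2 / (2 * \<sigma>\<^sup>2))) - \<Phi> x))"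
    and "filtered_prob_space M F"
    and "wiener_process M F W"
    and "maximal_sde_solution \<mu> M F W b c T"
  shows "AE \<omega> in M. T \<omega> \<le> ereal (\<sigma>\<^sup>2)"
proof -
  define k where "k = 1 / \<sigma>\<^sup>2"
  have k_pos: "0 < k"
    using \<open>\<sigma> > 0\<close> by (simp add: k_def)
  have \<mu>: "\<mu> = density lborel (\<lambda>x. exp_ereal (ereal (- (k * x\<^sup>2 / 2)) - \<Phi> x))"
    using assms(7) by (simp add: k_def mult.commute)
  let ?A = "\<lambda>s \<omega>. tilt_A \<mu> (b s \<omega>) (c s \<omega>)"
  have "AE \<omega> in M. continuous_on {t. 0 \<le> t \<and> ereal t < T \<omega>} (\<lambda>t. b t \<omega>) \<and>
      (\<forall>t. 0 \<le> t \<and> ereal t < T \<omega> \<longrightarrow> (b t \<omega>, c t \<omega>) \<in> sde_domain \<mu> \<and>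
        set_integrable lborel {0..t} (\<lambda>s. inverse (?A s \<omega>) ^ 2) \<and>
        b t \<omega> = (LBINT s:{0..t}. inverse (?A s \<omega>) ^ 2))"
    using assms(10) unfolding maximal_sde_solution_def sde_solution_def Let_def
    by (elim conjE) (erule eventually_mono, blast)
  then show ?thesis
  proof eventually_elim
    case (elim \<omega>)
    show ?case
    proof (rule ccontr)
      \<comment> \<open>A path alive beyond \<open>\<sigma>\<^sup>2\<close> is continuous on the
        closed interval up to that time, so the explosion bound applies with
        \<open>S = \<sigma>\<^sup>2 = 1 / k\<close>.\<close>
      assume "\<not> T \<omega> \<le> ereal (\<sigma>\<^sup>2)"
      then have alive: "ereal t < T \<omega>" if "t \<le> \<sigma>\<^sup>2" for t
        using that by (meson ereal_less_eq(3) le_less_trans not_le)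
      have cont: "continuous_on {0..\<sigma>\<^sup>2} (\<lambda>t. b t \<omega>)"
        using elim alive by (auto elim: continuous_on_subset)
      have speed: "(b t \<omega> + k)\<^sup>2 \<le> (inverse (?A t \<omega>))\<^sup>2" if "t \<in> {0..\<sigma>\<^sup>2}" for t
      proof -
        have dom: "(b t \<omega>, c t \<omega>) \<in> sde_domain \<mu>"
          using elim alive that by auto
        then have "0 < ?A t \<omega>" "0 \<le> b t \<omega>"
          by (auto simp: sde_domain_def)
        moreover have "(b t \<omega> + k) * ?A t \<omega> \<le> 1"
          by (rule tilt_A_le[OF assms(5,6) \<mu> dom])
        ultimately show ?thesis
          using k_pos by (intro power_mono) (auto simp: field_simps)
      qed
      have "integral {0..t} (\<lambda>s. (b s \<omega> + k)\<^sup>2) \<le> b t \<omega>" if "t \<in> {0..\<sigma>\<^sup>2}" for t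
      proof -
        have int: "set_integrable lborel {0..t} (\<lambda>s. (inverse (?A s \<omega>))\<^sup>2)"
          and b: "b t \<omega> = (LBINT s:{0..t}. (inverse (?A s \<omega>))\<^sup>2)"
          using elim alive that by auto
        \<comment> \<open>The system is stated with Lebesgue integrals and the explosion lemma with
          gauge integrals; set integrability identifies the two.\<close>
        have "integral {0..t} (\<lambda>s. (b s \<omega> + k)\<^sup>2) \<le> integral {0..t} (\<lambda>s. (inverse (?A s \<omega>))\<^sup>2)"
        proof (rule integral_le)
          show "(\<lambda>s. (b s \<omega> + k)\<^sup>2) integrable_on {0..t}"
            using that
            by (intro integrable_continuous_real continuous_intros continuous_on_subset[OF cont]) auto
        qed (use set_borel_integral_eq_integral(1)[OF int] speed that in auto)
        then show ?thesis
          using set_borel_integral_eq_integral(2)[OF int] b by simp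
      qed
      then have "\<sigma>\<^sup>2 < 1 / k"
        by (intro riccati_explosion[OF k_pos _ cont]) auto
      then show False
        by (simp add: k_def)
    qed
  qed
qed

end
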